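(* Let $n\ge1$, $A\in\mathbb R^{n\times n}$, $v,w\in\mathbb R^n$, $A_2=A+vw^\top$, and assume that no product of two eigenvalues drawn from $\sigma(A)\cup\sigma(A_2)$ (self-pairs and repeats included) equals $1$. Let $P,Q,R\in\mathbb R^{n\times n}$ be the unique solutions of $$P=APA^\top+vv^\top,\qquad Q=A_2^\top QA_2+ww^\top,\qquad R=ARA_2+vw^\top.$$ Then, with no nonsingularity or stability hypothesis, $$\det(R)^2\,\det(I+PQ)=\det(P)\det(Q).$$
   Context: $\sigma(M)$ is the multiset of complex eigenvalues of $M$. If $\alpha_i$ and $\beta_j$ enumerate $\sigma(A)$ and $\sigma(A_2)$, the hypothesis says $\alpha_i\alpha_j\ne1$, $\beta_i\beta_j\ne1$, $\alpha_i\beta_j\ne1$ for all $i,j$; this is exactly the condition that all three equations are uniquely solvable. *)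

theory Defs
  imports "Jordan_Normal_Form.Spectral_Radius"
begin

text \<open>The rank-one matrix $v w^T$.\<close>

definition outer_prod :: "'a :: semiring_0 vec \<Rightarrow> 'a vec \<Rightarrow> 'a mat" where
  "outer_prod v w = mat (dim_vec v) (dim_vec w) (\<lambda>(i, j). v $ i * w $ j)"

abbreviation complex_spectrum :: "real mat \<Rightarrow> complex set" where
  "complex_spectrum A \<equiv> spectrum (map_mat complex_of_real A)"

definition stein_solution :: "nat \<Rightarrow> real mat \<Rightarrow> real mat \<Rightarrow> real mat \<Rightarrow> real mat \<Rightarrow> bool" where
  "stein_solution n A B C X \<longleftrightarrow> X \<in> carrier_mat n n \<and> X = A * X * B + C"

end

theory Submission
  imports Defs
begin

text \<open>
  Let \<open>p\<close> be the characteristic polynomial of \<open>A\<close>, \<open>p\<^sup>*\<close> its reversal and \<open>B = A\<^sub>2\<close>. The spectral hypothesis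
  makes \<open>p\<^sup>*(B)\<close> invertible. Telescoping \<open>R = A R B + v w\<^sup>T\<close> with \<open>p(A) = 0\<close> gives \<open>R p\<^sup>*(B) = N J O\<close>, where \<open>O\<close>
  has the rows \<open>w\<^sup>T B\<^sup>i\<close>, \<open>N\<close> collects the coefficients of \<open>adj (x I - A) v\<close>, and \<open>J\<close> reverses the order;
  this settles existence and uniqueness, and \<open>B = A + v w\<^sup>T\<close> gives \<open>p(B) = N O\<close>. Telescoping the equation
  for \<open>Q\<close> gives \<open>p\<^sup>*(B)\<^sup>T Q p\<^sup>*(B) - p(B)\<^sup>T Q p(B) = O\<^sup>T G O\<close> with the Bezoutian \<open>G\<close> of \<open>p\<close> and \<open>p\<^sup>*\<close>. The same
  identity for \<open>P\<close>, where \<open>p(A\<^sup>T) = 0\<close>, shows \<open>N\<^sup>T P\<^sup>-\<^sup>1 N = G\<close> when \<open>P\<close> is invertible. Hence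
  \<open>p\<^sup>*(B)\<^sup>T Q p\<^sup>*(B) = p(B)\<^sup>T (P\<^sup>-\<^sup>1 + Q) p(B)\<close>, and determinants give the claim since
  \<open>det R det p\<^sup>*(B) = \<plusminus> det p(B)\<close>. If \<open>P\<close> is singular then so is \<open>N\<close>, and both sides vanish.
\<close>

section \<open>Polynomials in a matrix\<close>

text \<open>Entries are summed in the ring because a sum of matrices would need a zero matrix that
  depends on the dimension.\<close>

definition mat_poly :: "'a :: comm_ring_1 poly \<Rightarrow> 'a mat \<Rightarrow> 'a mat" where
  "mat_poly p A = mat (dim_row A) (dim_row A)
     (\<lambda>(i, j). \<Sum>k\<le>degree p. coeff p k * (A ^\<^sub>m k) $$ (i, j))"

lemma mat_poly_carrier [simp]: "A \<in> carrier_mat n n \<Longrightarrow> mat_poly p A \<in> carrier_mat n n"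
  by (auto simp: mat_poly_def)

text \<open>The bound \<open>N\<close> may exceed the degree: the reversal of a polynomial loses
  degree when 0 is a root, yet its sums must run to the same \<open>n\<close> as those of the
  polynomial itself.\<close>

lemma mat_poly_index:
  assumes "A \<in> carrier_mat n n" "degree p \<le> N" "i < n" "j < n"
  shows "mat_poly p A $$ (i, j) = (\<Sum>k\<le>N. coeff p k * (A ^\<^sub>m k) $$ (i, j))"
proof -
  have "(\<Sum>k\<le>degree p. coeff p k * (A ^\<^sub>m k) $$ (i, j)) = (\<Sum>k\<le>N. coeff p k * (A ^\<^sub>m k) $$ (i, j))"
    using assms(2) by (intro sum.mono_neutral_left) (auto simp: coeff_eq_0)
  then show ?thesis using assms by (auto simp: mat_poly_def)
qed

lemma index_mult_mat_sum:
  assumes "M \<in> carrier_mat nr n" "A \<in> carrier_mat n nc" "i < nr" "j < nc"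
  shows "(M * A) $$ (i, j) = (\<Sum>x<n. M $$ (i, x) * A $$ (x, j))"
  using assms by (auto simp: scalar_prod_def atLeast0LessThan)

lemma pow_mat_carrier:
  "A \<in> carrier_mat n n \<Longrightarrow> A ^\<^sub>m k \<in> carrier_mat n n"
  by simp

lemma mult_mat_poly_index:
  assumes A: "A \<in> carrier_mat n n" and p: "degree p \<le> N"
    and M: "M \<in> carrier_mat nr n" and ij: "i < nr" "j < n"
  shows "(M * mat_poly p A) $$ (i, j) = (\<Sum>k\<le>N. coeff p k * (M * A ^\<^sub>m k) $$ (i, j))"
proof -
  have "(M * mat_poly p A) $$ (i, j) = (\<Sum>x<n. \<Sum>k\<le>N. M $$ (i, x) * (coeff p k * (A ^\<^sub>m k) $$ (x, j)))"
    using assms by (simp add: index_mult_mat_sum[OF M mat_poly_carrier[OF A]] mat_poly_index[OF A p]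
        sum_distrib_left del: index_mult_mat)
  also have "\<dots> = (\<Sum>k\<le>N. coeff p k * (M * A ^\<^sub>m k) $$ (i, j))"
    by (subst sum.swap) (simp add: index_mult_mat_sum[OF M pow_mat_carrier[OF A] ij]
        sum_distrib_left ac_simps del: index_mult_mat)
  finally show ?thesis .
qed

lemma mat_poly_mult_index:
  assumes A: "A \<in> carrier_mat n n" and p: "degree p \<le> N"
    and M: "M \<in> carrier_mat n nc" and ij: "i < n" "j < nc"
  shows "(mat_poly p A * M) $$ (i, j) = (\<Sum>k\<le>N. coeff p k * (A ^\<^sub>m k * M) $$ (i, j))"
proof -
  have "(mat_poly p A * M) $$ (i, j) = (\<Sum>x<n. \<Sum>k\<le>N. (coeff p k * (A ^\<^sub>m k) $$ (i, x)) * M $$ (x, j))"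
    using assms by (simp add: index_mult_mat_sum[OF mat_poly_carrier[OF A] M] mat_poly_index[OF A p]
        sum_distrib_right del: index_mult_mat)
  also have "\<dots> = (\<Sum>k\<le>N. coeff p k * (A ^\<^sub>m k * M) $$ (i, j))"
    by (subst sum.swap) (simp add: index_mult_mat_sum[OF pow_mat_carrier[OF A] M ij]
        sum_distrib_left ac_simps del: index_mult_mat)
  finally show ?thesis .
qed

lemma pow_mat_Suc_left:
  fixes A :: "'a :: semiring_1 mat"
  assumes A: "A \<in> carrier_mat n n"
  shows "A ^\<^sub>m Suc k = A * A ^\<^sub>m k"
proof (induction k)
  case 0
  then show ?case using A by simp
next
  case (Suc k)
  have "A ^\<^sub>m Suc (Suc k) = (A * A ^\<^sub>m k) * A" using Suc by simp
  also have "\<dots> = A * (A ^\<^sub>m k * A)" using A by (intro assoc_mult_mat) auto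
  finally show ?case by simp
qed

lemma mat_poly_commute:
  assumes A: "A \<in> carrier_mat n n"
  shows "A * mat_poly p A = mat_poly p A * A"
proof (rule eq_matI)
  fix i j assume "i < dim_row (mat_poly p A * A)" "j < dim_col (mat_poly p A * A)"
  then have ij: "i < n" "j < n" using A by (auto simp: mat_poly_def)
  show "(A * mat_poly p A) $$ (i, j) = (mat_poly p A * A) $$ (i, j)"
    unfolding mult_mat_poly_index[OF A le_refl A ij] mat_poly_mult_index[OF A le_refl A ij]
    using pow_mat_Suc_left[OF A] by simp
qed (use A in \<open>auto simp: mat_poly_def\<close>)

text \<open>As \<open>1 - a x\<close> is the reversal of \<open>x - a\<close>, this peels one root
  off a reversed product. The coefficients of the product are
  \<open>p_k - a p_(k-1)\<close>.\<close>

lemma mat_poly_linear_mult: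
  assumes B: "B \<in> carrier_mat n n"
  shows "mat_poly ([:1, - a:] * p) B = (1\<^sub>m n - a \<cdot>\<^sub>m B) * mat_poly p B"
proof (rule eq_matI)
  fix i j assume "i < dim_row ((1\<^sub>m n - a \<cdot>\<^sub>m B) * mat_poly p B)" "j < dim_col ((1\<^sub>m n - a \<cdot>\<^sub>m B) * mat_poly p B)"
  then have ij: "i < n" "j < n" using B by (auto simp: mat_poly_def)
  define N where "N = degree p"
  \<comment> \<open>Only an upper bound, since the degree does not grow when
    \<open>a = 0\<close>.\<close>
  have deg: "degree ([:1, - a:] * p) \<le> Suc N"
    using degree_mult_le[of "[:1, - a:]" p] by (auto simp: N_def split: if_splits)
  define b where "b k = (B ^\<^sub>m k) $$ (i, j)" for k
  have bS: "(B * B ^\<^sub>m k) $$ (i, j) = b (Suc k)" for k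
    using pow_mat_Suc_left[OF B] by (simp add: b_def)
  have co: "coeff ([:1, - a:] * p) k = coeff p k - a * (case k of 0 \<Rightarrow> 0 | Suc m \<Rightarrow> coeff p m)" for k
    by (auto split: nat.split)
  have "mat_poly ([:1, - a:] * p) B $$ (i, j) = (\<Sum>k\<le>Suc N. coeff ([:1, - a:] * p) k * b k)"
    unfolding b_def by (rule mat_poly_index[OF B deg ij])
  also have "\<dots> = (\<Sum>k\<le>Suc N. coeff p k * b k) - a * (\<Sum>k\<le>N. coeff p k * b (Suc k))"
    unfolding co by (simp only: left_diff_distrib sum_subtractf sum.atMost_Suc_shift)
      (simp add: sum_distrib_left ac_simps)
  also have "(\<Sum>k\<le>Suc N. coeff p k * b k) = mat_poly p B $$ (i, j)"
    unfolding b_def by (rule mat_poly_index[OF B _ ij, symmetric]) (simp add: N_def)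
  also have "(\<Sum>k\<le>N. coeff p k * b (Suc k)) = (B * mat_poly p B) $$ (i, j)"
    using mult_mat_poly_index[OF B _ B ij, of p N] by (simp add: N_def bS)
  also have "mat_poly p B $$ (i, j) - a * (B * mat_poly p B) $$ (i, j)
     = (mat_poly p B - a \<cdot>\<^sub>m (B * mat_poly p B)) $$ (i, j)"
    using ij B carrier_matD[OF mat_poly_carrier[OF B, of p]] by simp
  also have "mat_poly p B - a \<cdot>\<^sub>m (B * mat_poly p B) = (1\<^sub>m n - a \<cdot>\<^sub>m B) * mat_poly p B"
    using B mat_poly_carrier[OF B, of p] by (simp add: minus_mult_distrib_mat[of _ n n _ _ n] left_mult_one_mat[of _ n n] mult_smult_assoc_mat[of _ n n _ n])
  finally show "mat_poly ([:1, - a:] * p) B $$ (i, j) = ((1\<^sub>m n - a \<cdot>\<^sub>m B) * mat_poly p B) $$ (i, j)" .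
qed (use B in \<open>auto simp: mat_poly_def\<close>)

section \<open>Invertibility of the reversed characteristic polynomial at a matrix\<close>

lemma mat_poly_one: "B \<in> carrier_mat n n \<Longrightarrow> mat_poly 1 B = 1\<^sub>m n"
  by (auto simp: mat_poly_def)

text \<open>Reversal is multiplicative, so the matrix is a product of factors \<open>I - a B\<close>
  over the listed roots.\<close>

lemma det_mat_poly_reflect:
  fixes B :: "'a :: field mat"
  assumes B: "B \<in> carrier_mat n n" and "\<And>a. a \<in> set as \<Longrightarrow> det (1\<^sub>m n - a \<cdot>\<^sub>m B) \<noteq> 0"
  shows "det (mat_poly (reflect_poly (\<Prod>a\<leftarrow>as. [:- a, 1:])) B) \<noteq> 0"
  using assms(2)
proof (induction as)
  case Nil
  then show ?case by (simp add: mat_poly_one[OF B])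
next
  case (Cons a as)
  \<comment> \<open>Also correct for \<open>a = 0\<close>, where both sides are the constant
    1.\<close>
  have "reflect_poly [:- a, 1:] = [:1, - a:]"
    by (intro poly_eqI) (auto simp: coeff_reflect_poly coeff_pCons split: nat.splits)
  then have "mat_poly (reflect_poly (\<Prod>a\<leftarrow>a # as. [:- a, 1:])) B
      = (1\<^sub>m n - a \<cdot>\<^sub>m B) * mat_poly (reflect_poly (\<Prod>a\<leftarrow>as. [:- a, 1:])) B"
    by (simp add: reflect_poly_mult mat_poly_linear_mult[OF B] del: mult_pCons_left)
  moreover have "1\<^sub>m n - a \<cdot>\<^sub>m B \<in> carrier_mat n n" using B by auto
  ultimately show ?case using Cons B by (simp add: det_mult[of _ n])
qed

text \<open>For nonzero \<open>a\<close>, \<open>I - a B\<close> is \<open>-a\<close> times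
  \<open>B - (1/a) I\<close>, which is singular only if \<open>1/a\<close> is an eigenvalue.\<close>

lemma det_one_minus_smult:
  fixes B :: "'a :: field mat"
  assumes B: "B \<in> carrier_mat n n" and "\<And>b. b \<in> spectrum B \<Longrightarrow> a * b \<noteq> 1"
  shows "det (1\<^sub>m n - a \<cdot>\<^sub>m B) \<noteq> 0"
proof (cases "a = 0")
  case True
  then have "1\<^sub>m n - a \<cdot>\<^sub>m B = 1\<^sub>m n" using B by (intro eq_matI) auto
  then show ?thesis by simp
next
  case False
  have eq: "1\<^sub>m n - a \<cdot>\<^sub>m B = (- a) \<cdot>\<^sub>m char_matrix B (1 / a)"
    using B False by (intro eq_matI) (auto simp: char_matrix_def field_simps)
  have "\<not> eigenvalue B (1 / a)" using assms(2)[of "1 / a"] False by (auto simp: spectrum_def)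
  then show ?thesis unfolding eq using eigenvalue_det[OF B, of "1 / a"] False by simp
qed

lemma of_real_mat_pow:
  assumes B: "B \<in> carrier_mat n n"
  shows "map_mat complex_of_real (B ^\<^sub>m k) = map_mat complex_of_real B ^\<^sub>m k"
proof (induction k)
  case (Suc k)
  then show ?case using B
    by (simp add: of_real_hom.mat_hom_mult[of _ n n _ n])
qed (use B in \<open>auto simp: of_real_hom.mat_hom_one\<close>)

text \<open>Over the complex numbers the characteristic polynomial splits, so the factorwise
  criterion applies; the embedding of the reals preserves determinants, which brings the result
  back.\<close>

lemma det_mat_poly_reflect_char_poly:
  assumes A: "A \<in> carrier_mat n n" and B: "B \<in> carrier_mat n n"
    and sp: "\<And>\<alpha> \<beta>. \<alpha> \<in> complex_spectrum A \<Longrightarrow> \<beta> \<in> complex_spectrum B \<Longrightarrow> \<alpha> * \<beta> \<noteq> 1"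
  shows "det (mat_poly (reflect_poly (char_poly A)) B) \<noteq> 0"
proof -
  let ?h = "map_mat complex_of_real"
  have hA: "?h A \<in> carrier_mat n n" and hB: "?h B \<in> carrier_mat n n" using A B by auto
  obtain as where as: "char_poly (?h A) = (\<Prod>a\<leftarrow>as. [:- a, 1:])"
    using char_poly_factorized[OF hA] by blast
  have "a \<in> complex_spectrum A" if "a \<in> set as" for a
    using that hA by (force simp: spectrum_def eigenvalue_root_char_poly as poly_prod_list prod_list_zero_iff)
  then have "det (mat_poly (reflect_poly (char_poly (?h A))) (?h B)) \<noteq> 0"
    unfolding as using sp by (intro det_mat_poly_reflect[OF hB] det_one_minus_smult[OF hB]) blast
  moreover have "mat_poly (reflect_poly (char_poly (?h A))) (?h B) = ?h (mat_poly (reflect_poly (char_poly A)) B)"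
  proof (rule eq_matI)
    fix i j assume "i < dim_row (?h (mat_poly (reflect_poly (char_poly A)) B))"
      "j < dim_col (?h (mat_poly (reflect_poly (char_poly A)) B))"
    then have ij: "i < n" "j < n" using B by (auto simp: mat_poly_def)
    \<comment> \<open>Reversal depends on the degree, so it commutes with the embedding only because
      both degrees are \<open>n\<close>.\<close>
    have d: "degree (char_poly A) = n" "degree (char_poly (?h A)) = n"
      using degree_monic_char_poly[OF A] degree_monic_char_poly[OF hA] by auto
    have le: "degree (reflect_poly (char_poly A)) \<le> n" "degree (reflect_poly (char_poly (?h A))) \<le> n"
      using degree_reflect_poly_le[of "char_poly A"] degree_reflect_poly_le[of "char_poly (?h A)"] d by auto
    have c: "coeff (reflect_poly (char_poly (?h A))) k = of_real (coeff (reflect_poly (char_poly A)) k)" for k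
      unfolding coeff_reflect_poly d by (simp add: of_real_hom.char_poly_hom[OF A])
    have pw: "(?h B ^\<^sub>m k) $$ (i, j) = of_real ((B ^\<^sub>m k) $$ (i, j))" for k
      using B ij by (simp flip: of_real_mat_pow[OF B])
    show "mat_poly (reflect_poly (char_poly (?h A))) (?h B) $$ (i, j)
        = ?h (mat_poly (reflect_poly (char_poly A)) B) $$ (i, j)"
      using ij carrier_matD[OF mat_poly_carrier[OF B, of "reflect_poly (char_poly A)"]]
      by (simp add: mat_poly_index[OF hB le(2) ij] mat_poly_index[OF B le(1) ij] c pw)
  qed (use B in \<open>auto simp: mat_poly_def\<close>)
  ultimately show ?thesis by (simp add: of_real_hom.hom_det)
qed

section \<open>The Cayley-Hamilton theorem\<close>

text \<open>Let \<open>D_k\<close> be the coefficient matrices of \<open>adj (x I - A)\<close>.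
  Comparing coefficients in \<open>adj (x I - A) (x I - A) = p(x) I\<close> gives
  \<open>D_(k-1) - D_k A = p_k I\<close>; multiplying by \<open>A^k\<close> on the right and summing
  over \<open>k\<close> telescopes to zero.\<close>

theorem cayley_hamilton:
  fixes A :: "'a :: comm_ring_1 mat"
  assumes A: "A \<in> carrier_mat n n"
  shows "mat_poly (char_poly A) A = 0\<^sub>m n n"
proof -
  define C where "C = char_poly_matrix A"
  define D where "D k = map_mat (\<lambda>p. coeff p k) (adj_mat C)" for k
  have C: "C \<in> carrier_mat n n" using A by (simp add: C_def)
  have adj: "adj_mat C \<in> carrier_mat n n" "adj_mat C * C = char_poly A \<cdot>\<^sub>m 1\<^sub>m n"
    using adj_mat[OF C] by (auto simp: C_def char_poly_def)
  have D: "D k \<in> carrier_mat n n" for k using adj by (simp add: D_def)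
  \<comment> \<open>The case \<open>0\<close> encodes \<open>D_(-1) = 0\<close>.\<close>
  have rec: "(case k of 0 \<Rightarrow> 0 | Suc m \<Rightarrow> D m $$ (i, j)) - (D k * A) $$ (i, j)
      = (if i = j then coeff (char_poly A) k else 0)" if ij: "i < n" "j < n" for i j k
  proof -
    let ?d = "\<lambda>x. adj_mat C $$ (i, x)"
    have "(if i = j then char_poly A else 0) = (adj_mat C * C) $$ (i, j)"
      unfolding adj(2) using ij by auto
    also have "\<dots> = (\<Sum>x<n. ?d x * C $$ (x, j))"
      by (rule index_mult_mat_sum[OF adj(1) C ij])
    also have "\<dots> = (\<Sum>x<n. (if x = j then pCons 0 (?d x) else 0) - Polynomial.smult (A $$ (x, j)) (?d x))"
      using A ij by (intro sum.cong) (auto simp: C_def char_poly_matrix_def)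
    also have "\<dots> = pCons 0 (?d j) - (\<Sum>x<n. Polynomial.smult (A $$ (x, j)) (?d x))"
      using ij by (simp add: sum_subtractf)
    finally have "coeff (if i = j then char_poly A else 0) k
       = coeff (pCons 0 (?d j) - (\<Sum>x<n. Polynomial.smult (A $$ (x, j)) (?d x))) k" by simp
    then show ?thesis
      unfolding index_mult_mat_sum[OF D A ij] using ij adj(1)
      by (auto simp: D_def coeff_sum coeff_pCons ac_simps split: nat.splits if_splits)
  qed
  \<comment> \<open>\<open>N\<close> exceeds the degrees of \<open>p\<close> and of all adjugate
    entries, so the sum reaches every coefficient of \<open>p\<close> and its last term contains
    \<open>D N = 0\<close>.\<close>
  define S where "S = insert (degree (char_poly A)) ((\<lambda>ij. degree (adj_mat C $$ ij)) ` ({..<n} \<times> {..<n}))"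
  define N where "N = Suc (Max S)"
  have le: "d < N" if "d \<in> S" for d
    using Max_ge[of S d] that by (auto simp: N_def S_def less_Suc_eq_le)
  have degN: "degree (char_poly A) \<le> N"
    using le[of "degree (char_poly A)"] by (simp add: S_def)
  have "D N $$ (i, j) = 0" if ij: "i < n" "j < n" for i j
  proof -
    have "degree (adj_mat C $$ (i, j)) < N"
      using ij by (intro le) (auto simp: S_def)
    then show ?thesis using ij adj(1) by (simp add: D_def coeff_eq_0)
  qed
  then have DN: "D N = 0\<^sub>m n n" using D[of N] by (intro eq_matI) auto
  show ?thesis
  proof (rule eq_matI)
    fix i j assume "i < dim_row (0\<^sub>m n n :: 'a mat)" "j < dim_col (0\<^sub>m n n :: 'a mat)"
    then have ij: "i < n" "j < n" by auto
    define f where "f k = (D k * A ^\<^sub>m Suc k) $$ (i, j)" for k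
    have step: "coeff (char_poly A) k * (A ^\<^sub>m k) $$ (i, j) = (case k of 0 \<Rightarrow> 0 | Suc m \<Rightarrow> f m) - f k" for k
    proof -
      have "f k = ((D k * A) * A ^\<^sub>m k) $$ (i, j)"
        using A D by (simp add: f_def pow_mat_Suc_left[OF A] assoc_mult_mat[of _ n n _ n _ n] del: pow_mat.simps)
      also have "\<dots> = (\<Sum>x<n. (D k * A) $$ (i, x) * (A ^\<^sub>m k) $$ (x, j))"
        by (rule index_mult_mat_sum[OF mult_carrier_mat[OF D A] pow_mat_carrier[OF A] ij])
      also have "\<dots> = (\<Sum>x<n. (case k of 0 \<Rightarrow> 0 | Suc m \<Rightarrow> D m $$ (i, x)) * (A ^\<^sub>m k) $$ (x, j)
          - (if i = x then coeff (char_poly A) k * (A ^\<^sub>m k) $$ (x, j) else 0))"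
        using rec[OF ij(1), of _ k] by (intro sum.cong refl) (auto simp: algebra_simps)
      also have "\<dots> = (case k of 0 \<Rightarrow> 0 | Suc m \<Rightarrow> f m) - coeff (char_poly A) k * (A ^\<^sub>m k) $$ (i, j)"
        using ij by (simp add: sum_subtractf f_def index_mult_mat_sum[OF D pow_mat_carrier[OF A]]
            del: pow_mat.simps index_mult_mat split: nat.split)
      finally show ?thesis by simp
    qed
    have "(\<Sum>k\<le>M. (case k of 0 \<Rightarrow> 0 | Suc m \<Rightarrow> f m) - f k) = - f M" for M
      by (induction M) auto
    moreover have "f N = 0"
      using ij A by (simp add: f_def DN left_mult_zero_mat[of _ n n] del: pow_mat.simps)
    ultimately show "mat_poly (char_poly A) A $$ (i, j) = 0\<^sub>m n n $$ (i, j)"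
      using ij by (simp add: mat_poly_index[OF A degN ij] step)
  qed (use A in \<open>auto simp: mat_poly_def\<close>)
qed

section \<open>Krylov matrices and rank-one Stein equations\<close>

lemma outer_prod_carrier [simp]:
  "v \<in> carrier_vec n \<Longrightarrow> w \<in> carrier_vec m \<Longrightarrow> outer_prod v w \<in> carrier_mat n m"
  by (auto simp: outer_prod_def)

lemma mult_outer_prod:
  fixes A :: "'a :: comm_semiring_0 mat"
  assumes "A \<in> carrier_mat n n" "v \<in> carrier_vec n" "w \<in> carrier_vec m"
  shows "A * outer_prod v w = outer_prod (A *\<^sub>v v) w"
  using assms by (intro eq_matI) (auto simp: outer_prod_def scalar_prod_def sum_distrib_right mult.assoc)

lemma outer_prod_mult:
  fixes B :: "'a :: comm_semiring_0 mat"
  assumes "B \<in> carrier_mat m m" "v \<in> carrier_vec n" "w \<in> carrier_vec m"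
  shows "outer_prod v w * B = outer_prod v (transpose_mat B *\<^sub>v w)"
  using assms by (intro eq_matI) (auto simp: outer_prod_def scalar_prod_def sum_distrib_left ac_simps)

lemma transpose_outer_prod: "transpose_mat (outer_prod v w) = outer_prod w (v :: 'a :: comm_semiring_0 vec)"
  by (intro eq_matI) (auto simp: outer_prod_def ac_simps)

lemma transpose_pow_mat:
  fixes A :: "'a :: comm_semiring_1 mat"
  assumes A: "A \<in> carrier_mat n n"
  shows "transpose_mat (A ^\<^sub>m k) = transpose_mat A ^\<^sub>m k"
proof (induction k)
  case (Suc k)
  have "transpose_mat (A ^\<^sub>m Suc k) = transpose_mat (A ^\<^sub>m k * A)" by simp
  also have "\<dots> = transpose_mat A * transpose_mat A ^\<^sub>m k"
    using A Suc by (subst transpose_mult[of _ n n _ n]) auto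
  also have "\<dots> = transpose_mat A ^\<^sub>m Suc k"
    using A by (intro pow_mat_Suc_left[symmetric]) auto
  finally show ?case .
qed (use A in auto)

lemma transpose_mat_poly:
  assumes A: "A \<in> carrier_mat n n"
  shows "transpose_mat (mat_poly p A) = mat_poly p (transpose_mat A)"
proof (rule eq_matI)
  fix i j assume "i < dim_row (mat_poly p (transpose_mat A))" "j < dim_col (mat_poly p (transpose_mat A))"
  then have ij: "i < n" "j < n" using A by (auto simp: mat_poly_def)
  have "(transpose_mat A ^\<^sub>m k) $$ (i, j) = (A ^\<^sub>m k) $$ (j, i)" for k
    using A ij by (simp flip: transpose_pow_mat[OF A])
  then show "transpose_mat (mat_poly p A) $$ (i, j) = mat_poly p (transpose_mat A) $$ (i, j)"
    using A ij carrier_matD[OF mat_poly_carrier[OF A, of p]]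
    by (simp add: mat_poly_index[OF _ le_refl, of _ n])
qed (use A in \<open>auto simp: mat_poly_def\<close>)

section \<open>The order-reversing permutation matrix\<close>

definition exchange_mat :: "nat \<Rightarrow> 'a :: zero_neq_one mat" where
  "exchange_mat n = mat n n (\<lambda>(i, j). if i + j + 1 = n then 1 else 0)"

lemma exchange_mat_carrier [simp]: "exchange_mat n \<in> carrier_mat n n"
  by (simp add: exchange_mat_def)

lemma mult_exchange_mat_index:
  fixes M :: "'a :: semiring_1 mat"
  assumes M: "M \<in> carrier_mat nr n" and i: "i < nr" and m: "m < n"
  shows "(M * exchange_mat n) $$ (i, m) = M $$ (i, n - 1 - m)"
proof -
  have "(M * exchange_mat n) $$ (i, m) = (\<Sum>x<n. M $$ (i, x) * exchange_mat n $$ (x, m))"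
    by (rule index_mult_mat_sum[OF M exchange_mat_carrier i m])
  also have "\<dots> = (\<Sum>x<n. if x = n - 1 - m then M $$ (i, x) else 0)"
    using m by (intro sum.cong) (auto simp: exchange_mat_def)
  finally show ?thesis using m by simp
qed

lemma exchange_mat_mult_index:
  fixes M :: "'a :: semiring_1 mat"
  assumes M: "M \<in> carrier_mat n nc" and i: "i < n" and m: "m < nc"
  shows "(exchange_mat n * M) $$ (i, m) = M $$ (n - 1 - i, m)"
proof -
  have "(exchange_mat n * M) $$ (i, m) = (\<Sum>x<n. exchange_mat n $$ (i, x) * M $$ (x, m))"
    by (rule index_mult_mat_sum[OF exchange_mat_carrier M i m])
  also have "\<dots> = (\<Sum>x<n. if x = n - 1 - i then M $$ (x, m) else 0)"
    using i by (intro sum.cong) (auto simp: exchange_mat_def)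
  finally show ?thesis using i by simp
qed

lemma exchange_mat_square: "exchange_mat n * exchange_mat n = (1\<^sub>m n :: 'a :: semiring_1 mat)"
proof (rule eq_matI)
  fix i j assume "i < dim_row (1\<^sub>m n :: 'a mat)" "j < dim_col (1\<^sub>m n :: 'a mat)"
  then have ij: "i < n" "j < n" by auto
  show "(exchange_mat n * exchange_mat n) $$ (i, j) = (1\<^sub>m n :: 'a mat) $$ (i, j)"
    unfolding mult_exchange_mat_index[OF exchange_mat_carrier ij] using ij by (auto simp: exchange_mat_def)
qed (simp_all add: exchange_mat_def)

lemma transpose_exchange_mat: "transpose_mat (exchange_mat n) = exchange_mat n"
  by (intro eq_matI) (auto simp: exchange_mat_def)

text \<open>Telescoped Stein sums have this shape: the inner indices of the two factors add up to
  \<open>n - 1\<close>.\<close>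

lemma mult_exchange_mult_index:
  fixes M :: "'a :: semiring_1 mat"
  assumes M: "M \<in> carrier_mat nr n" and L: "L \<in> carrier_mat n nc" and ij: "i < nr" "j < nc"
  shows "(M * exchange_mat n * L) $$ (i, j) = (\<Sum>m<n. M $$ (i, m) * L $$ (n - 1 - m, j))"
proof -
  have "(M * exchange_mat n * L) $$ (i, j) = (\<Sum>m<n. M $$ (i, n - 1 - m) * L $$ (m, j))"
    unfolding index_mult_mat_sum[OF mult_carrier_mat[OF M exchange_mat_carrier] L ij]
    using mult_exchange_mat_index[OF M ij(1)] by simp
  also have "\<dots> = (\<Sum>m<n. M $$ (i, m) * L $$ (n - 1 - m, j))"
    by (rule sum.reindex_bij_witness[of _ "\<lambda>m. n - 1 - m" "\<lambda>m. n - 1 - m"]) auto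
  finally show ?thesis .
qed

text \<open>In the notation of the overview, \<open>O\<close> is
  \<open>transpose_mat (krylov (transpose_mat B) w)\<close> and \<open>N\<close> is
  \<open>char_krylov A v\<close>.\<close>

definition krylov :: "'a :: comm_ring_1 mat \<Rightarrow> 'a vec \<Rightarrow> 'a mat" where
  "krylov A v = mat (dim_row A) (dim_row A) (\<lambda>(i, k). (A ^\<^sub>m k *\<^sub>v v) $ i)"

text \<open>The columns are the coefficients of \<open>adj (x I - A) v\<close> as a polynomial in \<open>x\<close>.\<close>

definition char_krylov :: "'a :: comm_ring_1 mat \<Rightarrow> 'a vec \<Rightarrow> 'a mat" where
  "char_krylov A v = mat (dim_row A) (dim_row A)
     (\<lambda>(i, m). \<Sum>k\<in>{m<..dim_row A}. coeff (char_poly A) k * (A ^\<^sub>m (k - 1 - m) *\<^sub>v v) $ i)"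

lemma krylov_carrier [simp]:
  "A \<in> carrier_mat n n \<Longrightarrow> krylov A v \<in> carrier_mat n n"
  "A \<in> carrier_mat n n \<Longrightarrow> char_krylov A v \<in> carrier_mat n n"
  by (auto simp: krylov_def char_krylov_def)

text \<open>The second factor is the triangular Hankel matrix of the coefficients of
  \<open>p\<close>. The factorization makes \<open>char_krylov A v\<close> singular whenever
  \<open>krylov A v\<close> is, which settles the case of singular \<open>P\<close>.\<close>

lemma char_krylov_eq_krylov_mult:
  fixes A :: "'a :: comm_ring_1 mat"
  assumes A: "A \<in> carrier_mat n n"
  shows "char_krylov A v = krylov A v *
    mat n n (\<lambda>(i, m). if i + m < n then coeff (char_poly A) (Suc (i + m)) else 0)"
    (is "_ = _ * ?U")
proof (rule eq_matI)
  fix i m assume "i < dim_row (krylov A v * ?U)" "m < dim_col (krylov A v * ?U)"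
  then have im: "i < n" "m < n" using A by (auto simp: krylov_def)
  have "(krylov A v * ?U) $$ (i, m) = (\<Sum>x<n. (A ^\<^sub>m x *\<^sub>v v) $ i * (if x + m < n then coeff (char_poly A) (Suc (x + m)) else 0))"
    using A im by (subst index_mult_mat_sum[of _ n n _ n]) (auto simp: krylov_def)
  also have "\<dots> = (\<Sum>x<n - m. (A ^\<^sub>m x *\<^sub>v v) $ i * coeff (char_poly A) (Suc (x + m)))"
    by (rule sum.mono_neutral_cong_right) auto
  also have "\<dots> = (\<Sum>k\<in>{m<..n}. coeff (char_poly A) k * (A ^\<^sub>m (k - 1 - m) *\<^sub>v v) $ i)"
    using im by (intro sum.reindex_bij_witness[of _ "\<lambda>k. k - 1 - m" "\<lambda>x. Suc (x + m)"]) (auto simp: mult.commute)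
  finally show "char_krylov A v $$ (i, m) = (krylov A v * ?U) $$ (i, m)"
    using A im by (simp add: char_krylov_def)
qed (use A in \<open>auto simp: krylov_def char_krylov_def\<close>)

text \<open>Regroups the triangle by \<open>m = k - 1 - l\<close>, the exponent that accompanies
  \<open>l\<close> in a telescoped sum.\<close>

lemma sum_triangle_reindex:
  fixes F :: "nat \<Rightarrow> nat \<Rightarrow> 'a :: comm_monoid_add"
  shows "(\<Sum>k\<le>n. \<Sum>l<k. F k l) = (\<Sum>m<n. \<Sum>k\<in>{m<..n}. F k (k - 1 - m))"
proof -
  have "(\<Sum>k\<le>n. \<Sum>l<k. F k l) = (\<Sum>(k, l)\<in>(SIGMA k:{..n}. {..<k}). F k l)"
    by (subst sum.Sigma) auto
  also have "\<dots> = (\<Sum>(m, k)\<in>(SIGMA m:{..<n}. {m<..n}). F k (k - 1 - m))"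
    by (rule sum.reindex_bij_witness[of _ "\<lambda>(m, k). (k, k - 1 - m)" "\<lambda>(k, l). (k - 1 - l, k)"]) auto
  also have "\<dots> = (\<Sum>m<n. \<Sum>k\<in>{m<..n}. F k (k - 1 - m))"
    by (subst sum.Sigma) auto
  finally show ?thesis .
qed

text \<open>The right side is the expansion of \<open>(p(s) - p(t)) / (s - t)\<close> with
  \<open>s^l\<close> replaced by an entry of \<open>A^l v\<close> and \<open>t^m\<close> by
  \<open>y m\<close>. Since \<open>y\<close> is arbitrary, it serves with ascending and with
  reversed indices.\<close>

lemma krylov_char_sum:
  fixes A :: "'a :: comm_ring_1 mat"
  assumes A: "A \<in> carrier_mat n n" and i: "i < n"
  shows "(\<Sum>m<n. char_krylov A v $$ (i, m) * y m)
    = (\<Sum>k\<le>n. \<Sum>l<k. coeff (char_poly A) k * (A ^\<^sub>m l *\<^sub>v v) $ i * y (k - 1 - l))"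
  unfolding sum_triangle_reindex using A i
  by (auto simp: char_krylov_def sum_distrib_right intro!: sum.cong)

section \<open>Telescoping with a rank-one right-hand side\<close>

lemma pow_outer_prod_pow_index:
  fixes A :: "'a :: comm_ring_1 mat"
  assumes A: "A \<in> carrier_mat n n" and B: "B \<in> carrier_mat n n"
    and v: "v \<in> carrier_vec n" and w: "w \<in> carrier_vec n" and ij: "i < n" "j < n"
  shows "(A ^\<^sub>m t * outer_prod v w * B ^\<^sub>m l) $$ (i, j)
    = (A ^\<^sub>m t *\<^sub>v v) $ i * (transpose_mat B ^\<^sub>m l *\<^sub>v w) $ j"
proof -
  have "A ^\<^sub>m t * outer_prod v w * B ^\<^sub>m l = outer_prod (A ^\<^sub>m t *\<^sub>v v) (transpose_mat B ^\<^sub>m l *\<^sub>v w)"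
    using A B v w
    by (simp add: mult_outer_prod[of _ n] outer_prod_mult[of _ n _ n] transpose_pow_mat mult_mat_vec_carrier[of _ n n])
  then show ?thesis using A B ij by (simp add: outer_prod_def)
qed

text \<open>Substituting the equation for \<open>R\<close> once raises both exponents by one at the
  price of a rank-one term. With transposes as coefficients it also covers the equations for
  \<open>P\<close> and \<open>Q\<close>.\<close>

lemma stein_pow_step:
  fixes A :: "'a :: comm_ring_1 mat"
  assumes A: "A \<in> carrier_mat n n" and B: "B \<in> carrier_mat n n"
    and v: "v \<in> carrier_vec n" and w: "w \<in> carrier_vec n" and ij: "i < n" "j < n"
    and R: "R \<in> carrier_mat n n" "R = A * R * B + outer_prod v w"
  shows "(A ^\<^sub>m t * R * B ^\<^sub>m l) $$ (i, j) = (A ^\<^sub>m Suc t * R * B ^\<^sub>m Suc l) $$ (i, j)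
    + (A ^\<^sub>m t *\<^sub>v v) $ i * (transpose_mat B ^\<^sub>m l *\<^sub>v w) $ j"
proof -
  note [simp] = mult_carrier_mat[of _ n n _ n] assoc_mult_mat[of _ n n _ n _ n]
  have "A ^\<^sub>m t * R * B ^\<^sub>m l = A ^\<^sub>m t * (A * R * B + outer_prod v w) * B ^\<^sub>m l"
    using R(2) by simp
  also have "\<dots> = A ^\<^sub>m t * (A * R * B) * B ^\<^sub>m l + A ^\<^sub>m t * outer_prod v w * B ^\<^sub>m l"
    using A B v w R(1) by (simp add: mult_add_distrib_mat[of _ n n _ n] add_mult_distrib_mat[of _ n n _ _ n])
  also have "A ^\<^sub>m t * (A * R * B) * B ^\<^sub>m l = A ^\<^sub>m Suc t * R * (B * B ^\<^sub>m l)"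
    using A B R(1) by simp
  finally show ?thesis
    unfolding pow_outer_prod_pow_index[OF A B v w ij, symmetric] pow_mat_Suc_left[OF B, symmetric]
    using A B R(1) v w ij by (simp del: pow_mat.simps assoc_mult_mat index_mult_mat(1))
qed

lemma mult_reflect_char_poly_index:
  fixes A :: "'a :: comm_ring_1 mat"
  assumes A: "A \<in> carrier_mat n n" and B: "B \<in> carrier_mat n n"
    and M: "M \<in> carrier_mat n n" and ij: "i < n" "j < n"
  shows "(M * mat_poly (reflect_poly (char_poly A)) B) $$ (i, j)
    = (\<Sum>k\<le>n. coeff (char_poly A) k * (M * B ^\<^sub>m (n - k)) $$ (i, j))"
proof -
  have d: "degree (char_poly A) = n" using degree_monic_char_poly[OF A] by simp
  have le: "degree (reflect_poly (char_poly A)) \<le> n"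
    using degree_reflect_poly_le[of "char_poly A"] d by simp
  show ?thesis
    unfolding mult_mat_poly_index[OF B le M ij]
    by (rule sum.reindex_bij_witness[of _ "\<lambda>k. n - k" "\<lambda>k. n - k"]) (auto simp: coeff_reflect_poly d)
qed

lemma char_poly_pow_sum:
  fixes A :: "'a :: comm_ring_1 mat"
  assumes A: "A \<in> carrier_mat n n" and M: "M \<in> carrier_mat n n" and ij: "i < n" "j < n"
  shows "(\<Sum>k\<le>n. coeff (char_poly A) k * (A ^\<^sub>m k * M) $$ (i, j)) = 0"
proof -
  have d: "degree (char_poly A) \<le> n" using degree_monic_char_poly[OF A] by simp
  show ?thesis
    using mat_poly_mult_index[OF A d M ij] cayley_hamilton[OF A] M ij by (simp add: left_mult_zero_mat[of _ n n])
qed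

text \<open>Iterating the step \<open>k\<close> times gives \<open>R B^(n-k) = A^k R B^n\<close>
  plus the sum over \<open>l < k\<close> of \<open>A^l v w^T B^(n-k+l)\<close>. Weighted by
  \<open>p_k\<close> and summed, the first parts give \<open>p(A) R B^n = 0\<close>.\<close>

lemma stein_mult_reflect_char_poly:
  fixes A :: "'a :: comm_ring_1 mat"
  assumes A: "A \<in> carrier_mat n n" and B: "B \<in> carrier_mat n n"
    and v: "v \<in> carrier_vec n" and w: "w \<in> carrier_vec n"
    and R: "R \<in> carrier_mat n n" "R = A * R * B + outer_prod v w"
  shows "R * mat_poly (reflect_poly (char_poly A)) B
    = char_krylov A v * exchange_mat n * transpose_mat (krylov (transpose_mat B) w)"
    (is "?L = ?N * _ * ?O")
proof (rule eq_matI)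
  have c: "?N \<in> carrier_mat n n" "?O \<in> carrier_mat n n" using A B by auto
  fix i j assume "i < dim_row (?N * exchange_mat n * ?O)" "j < dim_col (?N * exchange_mat n * ?O)"
  then have ij: "i < n" "j < n" using c by auto
  define s where "s t l = (A ^\<^sub>m t * R * B ^\<^sub>m l) $$ (i, j)" for t l
  define x where "x t = (A ^\<^sub>m t *\<^sub>v v) $ i" for t
  define y where "y t = (transpose_mat B ^\<^sub>m t *\<^sub>v w) $ j" for t
  define a where "a = coeff (char_poly A)"
  have step: "s t l = s (Suc t) (Suc l) + x t * y l" for t l
    unfolding s_def x_def y_def by (rule stein_pow_step[OF A B v w ij R])
  have tel: "s 0 m = s k (m + k) + (\<Sum>l<k. x l * y (m + l))" for m k
  proof (induction k)
    case (Suc k)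
    then show ?case using step[of k "m + k"] by (simp add: ac_simps)
  qed simp
  have zero: "(\<Sum>k\<le>n. a k * s k n) = 0"
    using char_poly_pow_sum[OF A, of "R * B ^\<^sub>m n", OF _ ij] A B R(1)
    by (simp add: s_def a_def assoc_mult_mat[of _ n n _ n _ n])
  have "?L $$ (i, j) = (\<Sum>k\<le>n. a k * s 0 (n - k))"
    using R(1) A by (simp add: mult_reflect_char_poly_index[OF A B R(1) ij] s_def a_def left_mult_one_mat[of _ n n])
  also have "\<dots> = (\<Sum>k\<le>n. a k * s k n + a k * (\<Sum>l<k. x l * y (n - k + l)))"
  proof (intro sum.cong refl)
    fix k assume "k \<in> {..n}"
    then show "a k * s 0 (n - k) = a k * s k n + a k * (\<Sum>l<k. x l * y (n - k + l))"
      using tel[where k = k and m = "n - k"] by (simp add: distrib_left)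
  qed
  \<comment> \<open>The exponent \<open>n - k + l\<close> is rewritten through
    \<open>m = k - 1 - l\<close> as \<open>n - 1 - m\<close>, which produces the reversal by
    \<open>J\<close>; truncated subtraction is harmless as \<open>l < k\<close> and
    \<open>k \<le> n\<close>.\<close>
  also have "\<dots> = (\<Sum>k\<le>n. \<Sum>l<k. a k * x l * y (n - 1 - (k - 1 - l)))"
    by (auto simp: sum.distrib zero sum_distrib_left ac_simps intro!: sum.cong arg_cong[of _ _ y])
  also have "\<dots> = (\<Sum>m<n. ?N $$ (i, m) * y (n - 1 - m))"
    unfolding a_def x_def by (rule krylov_char_sum[OF A ij(1), symmetric])
  also have "\<dots> = (?N * exchange_mat n * ?O) $$ (i, j)"
    unfolding mult_exchange_mult_index[OF c ij] using B ij by (simp add: y_def krylov_def)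
  finally show "?L $$ (i, j) = (?N * exchange_mat n * ?O) $$ (i, j)" .
qed (use A B R in \<open>auto simp: mat_poly_def krylov_def char_krylov_def\<close>)

text \<open>From \<open>B = A + v w^T\<close>, \<open>B^k\<close> is \<open>A^k\<close> plus the sum
  over \<open>l < k\<close> of \<open>A^l v w^T B^(k-1-l)\<close>; weighting by \<open>p_k\<close>
  removes the first part, as \<open>p(A) = 0\<close>. No reversal occurs here, hence no
  \<open>J\<close>.\<close>

lemma char_poly_rank_one_update:
  fixes A :: "'a :: comm_ring_1 mat"
  assumes A: "A \<in> carrier_mat n n" and v: "v \<in> carrier_vec n" and w: "w \<in> carrier_vec n"
    and B: "B = A + outer_prod v w"
  shows "mat_poly (char_poly A) B = char_krylov A v * transpose_mat (krylov (transpose_mat B) w)"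
    (is "?L = ?N * ?O")
proof (rule eq_matI)
  have Bc: "B \<in> carrier_mat n n" using A v w B by auto
  have c: "?N \<in> carrier_mat n n" "?O \<in> carrier_mat n n" using A Bc by auto
  fix i j assume "i < dim_row (?N * ?O)" "j < dim_col (?N * ?O)"
  then have ij: "i < n" "j < n" using c by auto
  define s where "s t l = (A ^\<^sub>m t * B ^\<^sub>m l) $$ (i, j)" for t l
  define x where "x t = (A ^\<^sub>m t *\<^sub>v v) $ i" for t
  define y where "y t = (transpose_mat B ^\<^sub>m t *\<^sub>v w) $ j" for t
  define a where "a = coeff (char_poly A)"
  have step: "s t (Suc l) = s (Suc t) l + x t * y l" for t l
  proof -
    have "A ^\<^sub>m t * B ^\<^sub>m Suc l = A ^\<^sub>m t * ((A + outer_prod v w) * B ^\<^sub>m l)"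
      using pow_mat_Suc_left[OF Bc] B by simp
    also have "\<dots> = A ^\<^sub>m Suc t * B ^\<^sub>m l + A ^\<^sub>m t * outer_prod v w * B ^\<^sub>m l"
      using A Bc v w
      by (simp add: add_mult_distrib_mat[of _ n n _ _ n] mult_add_distrib_mat[of _ n n _ n]
          mult_carrier_mat[of _ n n _ n] assoc_mult_mat[of _ n n _ n _ n])
    finally show ?thesis
      unfolding s_def x_def y_def pow_outer_prod_pow_index[OF A Bc v w ij, symmetric]
      using A Bc v w ij by (simp del: pow_mat.simps index_mult_mat(1))
  qed
  \<comment> \<open>Only \<open>m = 0\<close> is wanted; general \<open>m\<close> lets the induction
    use its hypothesis at \<open>Suc m\<close>.\<close>
  have tel: "s 0 (k + m) = s k m + (\<Sum>l<k. x l * y (m + k - 1 - l))" for m k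
  proof (induction k arbitrary: m)
    case (Suc k)
    show ?case using Suc[of "Suc m"] step[of k m] by (simp add: ac_simps)
  qed simp
  have "?L $$ (i, j) = (\<Sum>k\<le>n. a k * s 0 k)"
    using degree_monic_char_poly[OF A] Bc A
    by (simp add: mat_poly_index[OF Bc _ ij, of _ n] s_def a_def left_mult_one_mat[of _ n n])
  also have "\<dots> = (\<Sum>k\<le>n. a k * s k 0 + a k * (\<Sum>l<k. x l * y (k - 1 - l)))"
    using tel[where m = 0] by (simp add: algebra_simps)
  also have "\<dots> = (\<Sum>k\<le>n. \<Sum>l<k. a k * x l * y (k - 1 - l))"
    using char_poly_pow_sum[OF A, of "B ^\<^sub>m 0", OF _ ij] Bc
    by (simp add: sum.distrib s_def a_def sum_distrib_left ac_simps)
  also have "\<dots> = (\<Sum>m<n. ?N $$ (i, m) * y m)"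
    unfolding a_def x_def by (rule krylov_char_sum[OF A ij(1), symmetric])
  also have "\<dots> = (?N * ?O) $$ (i, j)"
    unfolding index_mult_mat_sum[OF c ij] using Bc ij by (simp add: y_def krylov_def)
  finally show "?L $$ (i, j) = (?N * ?O) $$ (i, j)" .
qed (use A B v w in \<open>auto simp: mat_poly_def krylov_def char_krylov_def outer_prod_def\<close>)

section \<open>The Bezoutian of a polynomial and its reversal\<close>

text \<open>The coefficients of the Bezoutian \<open>(p\<^sup>*(x) p\<^sup>*(y) - p(x) p(y)) / (1 - x y)\<close>, where \<open>a\<close> lists the
  coefficients of \<open>p\<close> and \<open>p\<^sup>*\<close> is the reversed polynomial.\<close>

definition bezout_num :: "nat \<Rightarrow> (nat \<Rightarrow> 'a :: comm_ring_1) \<Rightarrow> nat \<Rightarrow> nat \<Rightarrow> 'a" where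
  "bezout_num n a k l = a (n - k) * a (n - l) - a k * a l"

text \<open>Division by \<open>1 - x y\<close> as a power series: the numerator coefficients
  \<open>bezout_num\<close> are accumulated along a diagonal.\<close>

definition bezout_coeff :: "nat \<Rightarrow> (nat \<Rightarrow> 'a :: comm_ring_1) \<Rightarrow> nat \<Rightarrow> nat \<Rightarrow> 'a" where
  "bezout_coeff n a m l = (\<Sum>i\<le>min m l. bezout_num n a (m - i) (l - i))"

definition bezout_mat :: "nat \<Rightarrow> (nat \<Rightarrow> 'a :: comm_ring_1) \<Rightarrow> 'a mat" where
  "bezout_mat n a = mat n n (\<lambda>(m, l). bezout_coeff n a m l)"

lemma bezout_mat_carrier [simp]: "bezout_mat n a \<in> carrier_mat n n"
  by (simp add: bezout_mat_def)

lemma bezout_num_commute: "bezout_num n a k l = bezout_num n a l k"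
  by (simp add: bezout_num_def ac_simps)

lemma bezout_coeff_commute: "bezout_coeff n a m l = bezout_coeff n a l m"
  unfolding bezout_coeff_def by (subst bezout_num_commute) (simp add: min.commute)

text \<open>All coefficients on one diagonal are thereby partial sums of one sequence.\<close>

lemma bezout_coeff_le:
  assumes "m \<le> l"
  shows "bezout_coeff n a m l = (\<Sum>t\<le>m. bezout_num n a t (t + (l - m)))"
  unfolding bezout_coeff_def using assms
  by (intro sum.reindex_bij_witness[of _ "\<lambda>t. m - t" "\<lambda>i. m - i"]) (auto simp: min_def)

text \<open>The substitution of \<open>n - d - t\<close> for \<open>t\<close> exchanges the two
  products. In terms of polynomials, the numerator vanishes at \<open>y = 1/x\<close>, so
  \<open>1 - x y\<close> divides it.\<close>

lemma bezout_num_diagonal_sum: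
  assumes "d \<le> n"
  shows "(\<Sum>t\<le>n - d. bezout_num n a t (t + d)) = 0"
proof -
  have "(\<Sum>t\<le>n - d. a (n - t) * a (n - (t + d))) = (\<Sum>t\<le>n - d. a t * a (t + d))"
    using assms by (intro sum.reindex_bij_witness[of _ "\<lambda>t. n - d - t" "\<lambda>t. n - d - t"]) (auto simp: ac_simps)
  then show ?thesis by (simp add: bezout_num_def sum_subtractf)
qed

text \<open>At index \<open>n\<close> the partial sum is the whole diagonal. Hence the quotient has
  degree below \<open>n\<close> in each variable and fits into an \<open>n\<close> by
  \<open>n\<close> matrix.\<close>

lemma bezout_coeff_boundary: "k \<le> n \<Longrightarrow> bezout_coeff n a k n = 0"
  using bezout_num_diagonal_sum[of "n - k" n a] by (simp add: bezout_coeff_le)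

lemma bezout_coeff_boundary_left: "k \<le> n \<Longrightarrow> bezout_coeff n a n k = 0"
  using bezout_coeff_boundary[of k n a] by (simp add: bezout_coeff_commute)

text \<open>The numerator changes sign under \<open>(k, l)\<close> to \<open>(n - k, n - l)\<close>,
  so the reflected coefficient is minus the rest of the diagonal sum; the whole diagonal sums to
  zero.\<close>

lemma bezout_coeff_reflect:
  assumes "m < n" "l < n"
  shows "bezout_coeff n a (n - 1 - m) (n - 1 - l) = bezout_coeff n a m l"
proof -
  have *: "bezout_coeff n a (n - 1 - m) (n - 1 - l) = bezout_coeff n a m l" if ml: "m \<le> l" "l < n" for m l
  proof -
    define d where "d = l - m"
    define h where "h t = bezout_num n a t (t + d)" for t
    have "bezout_coeff n a (n - 1 - m) (n - 1 - l) = bezout_coeff n a (n - 1 - l) (n - 1 - m)"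
      by (rule bezout_coeff_commute)
    also have "\<dots> = (\<Sum>t\<le>n - 1 - l. h t)"
      using ml by (subst bezout_coeff_le) (auto simp: h_def d_def diff_le_mono2 intro!: sum.cong)
    also have "\<dots> = (\<Sum>t\<in>{m<..n - d}. - h t)"
      using ml by (intro sum.reindex_bij_witness[of _ "\<lambda>t. n - d - t" "\<lambda>t. n - d - t"])
        (auto simp: h_def d_def bezout_num_def ac_simps)
    also have "\<dots> = (\<Sum>t\<le>m. h t) - (\<Sum>t\<le>n - d. h t)"
    proof -
      have "{..n - d} = {..m} \<union> {m<..n - d}" using ml by (auto simp: d_def)
      then have "(\<Sum>t\<le>n - d. h t) = (\<Sum>t\<le>m. h t) + (\<Sum>t\<in>{m<..n - d}. h t)"
        by (simp add: sum.union_disjoint[symmetric] ivl_disj_int)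
      then show ?thesis by (simp add: sum_negf)
    qed
    also have "(\<Sum>t\<le>n - d. h t) = 0"
      unfolding h_def using ml by (intro bezout_num_diagonal_sum) (auto simp: d_def)
    also have "(\<Sum>t\<le>m. h t) - 0 = bezout_coeff n a m l"
      using ml by (simp add: bezout_coeff_le h_def d_def)
    finally show ?thesis .
  qed
  show ?thesis
    using *[of m l] *[of l m] assms by (metis bezout_coeff_commute nat_le_linear)
qed

text \<open>The equation for \<open>P\<close> yields a Gram matrix between two factors
  \<open>J\<close>; this removes them.\<close>

lemma exchange_bezout_exchange:
  "exchange_mat n * bezout_mat n a * exchange_mat n = bezout_mat n a"
proof (rule eq_matI)
  fix i j assume "i < dim_row (bezout_mat n a)" "j < dim_col (bezout_mat n a)"
  then have ij: "i < n" "j < n" by (auto simp: bezout_mat_def)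
  have j': "n - 1 - j < n" using ij by auto
  show "(exchange_mat n * bezout_mat n a * exchange_mat n) $$ (i, j) = bezout_mat n a $$ (i, j)"
    unfolding mult_exchange_mat_index[OF mult_carrier_mat[OF exchange_mat_carrier bezout_mat_carrier] ij]
      exchange_mat_mult_index[OF bezout_mat_carrier ij(1) j']
    using ij bezout_coeff_reflect[OF ij, of a] by (simp add: bezout_mat_def)
qed (simp_all add: exchange_mat_def bezout_mat_def)

text \<open>Summation by parts: the numerator is the Bezoutian minus its diagonal shift. Moving the
  shift onto \<open>s\<close> leaves \<open>s k l - s (Suc k) (Suc l) = x k * y l\<close>, and the
  boundary terms vanish.\<close>

lemma bezout_displacement_sum:
  fixes s :: "nat \<Rightarrow> nat \<Rightarrow> 'a :: comm_ring_1"
  assumes step: "\<And>k l. s k l = s (Suc k) (Suc l) + x k * y l"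
  shows "(\<Sum>k\<le>n. \<Sum>l\<le>n. bezout_num n a k l * s k l)
    = (\<Sum>m<n. \<Sum>l<n. x m * bezout_coeff n a m l * y l)"
proof -
  define g where "g = bezout_coeff n a"
  \<comment> \<open>The Bezoutian multiplied by \<open>x y\<close>: shifted along the diagonal, with
    zeros in row and column 0.\<close>
  define g' where "g' k l = (case k of 0 \<Rightarrow> 0 | Suc m \<Rightarrow> (case l of 0 \<Rightarrow> 0 | Suc r \<Rightarrow> g m r))" for k l
  have num: "bezout_num n a k l = g k l - g' k l" for k l
    by (cases k; cases l) (simp_all add: g_def g'_def bezout_coeff_def sum.atMost_Suc_shift del: sum.atMost_Suc)
  have 1: "(\<Sum>k\<le>n. \<Sum>l\<le>n. g k l * s k l) = (\<Sum>k<n. \<Sum>l<n. g k l * s k l)"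
    unfolding lessThan_Suc_atMost[symmetric]
    by (simp add: g_def bezout_coeff_boundary bezout_coeff_boundary_left)
  have 2: "(\<Sum>k\<le>n. \<Sum>l\<le>n. g' k l * s k l) = (\<Sum>k<n. \<Sum>l<n. g k l * s (Suc k) (Suc l))"
    unfolding lessThan_Suc_atMost[symmetric] sum.lessThan_Suc_shift
    by (simp add: g'_def)
  have "(\<Sum>k\<le>n. \<Sum>l\<le>n. bezout_num n a k l * s k l)
      = (\<Sum>k<n. \<Sum>l<n. g k l * s k l) - (\<Sum>k<n. \<Sum>l<n. g k l * s (Suc k) (Suc l))"
    by (simp add: num left_diff_distrib sum_subtractf 1 2)
  also have "\<dots> = (\<Sum>k<n. \<Sum>l<n. g k l * (s k l - s (Suc k) (Suc l)))"
    by (simp add: right_diff_distrib sum_subtractf)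
  also have "\<dots> = (\<Sum>m<n. \<Sum>l<n. x m * g m l * y l)"
  proof -
    have "s k l - s (Suc k) (Suc l) = x k * y l" for k l
      using step[of k l] by simp
    then show ?thesis by (simp add: ac_simps)
  qed
  finally show ?thesis by (simp add: g_def)
qed

section \<open>Bezoutian identity for solutions of a symmetric Stein equation\<close>

lemma mat_poly_transpose_mult_mat_poly_index:
  fixes B :: "'a :: comm_ring_1 mat"
  assumes B: "B \<in> carrier_mat n n" and Q: "Q \<in> carrier_mat n n"
    and p: "degree p \<le> n" and ij: "i < n" "j < n"
  shows "(transpose_mat (mat_poly p B) * Q * mat_poly p B) $$ (i, j)
    = (\<Sum>k\<le>n. \<Sum>l\<le>n. coeff p k * coeff p l * (transpose_mat B ^\<^sub>m k * Q * B ^\<^sub>m l) $$ (i, j))"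
proof -
  have T: "transpose_mat B \<in> carrier_mat n n" using B by simp
  have "(transpose_mat (mat_poly p B) * Q * mat_poly p B) $$ (i, j)
      = (mat_poly p (transpose_mat B) * (Q * mat_poly p B)) $$ (i, j)"
    unfolding transpose_mat_poly[OF B] using B Q by (simp add: assoc_mult_mat[of _ n n _ n _ n])
  also have "\<dots> = (\<Sum>k\<le>n. coeff p k * (transpose_mat B ^\<^sub>m k * (Q * mat_poly p B)) $$ (i, j))"
    by (rule mat_poly_mult_index[OF T p _ ij]) (use B Q in auto)
  also have "\<dots> = (\<Sum>k\<le>n. coeff p k * ((transpose_mat B ^\<^sub>m k * Q) * mat_poly p B) $$ (i, j))"
    using B Q by (simp add: assoc_mult_mat[of _ n n _ n _ n])
  also have "\<dots> = (\<Sum>k\<le>n. coeff p k * (\<Sum>l\<le>n. coeff p l * (transpose_mat B ^\<^sub>m k * Q * B ^\<^sub>m l) $$ (i, j)))"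
    using B Q by (intro sum.cong refl arg_cong2[of _ _ _ _ "(*)"] mult_mat_poly_index[OF B p _ ij]) auto
  finally show ?thesis by (simp add: sum_distrib_left ac_simps)
qed

text \<open>The two quadratic forms differ by the numerator coefficients paired with
  \<open>(B^T)^k Q B^l\<close>, to which summation by parts applies. It is used with the
  characteristic polynomial of \<open>A\<close> both at \<open>A2\<close>, for \<open>Q\<close>, and
  at \<open>transpose_mat A\<close>, for \<open>P\<close>.\<close>

lemma stein_bezout:
  fixes B :: "'a :: comm_ring_1 mat"
  assumes B: "B \<in> carrier_mat n n" and w: "w \<in> carrier_vec n"
    and Q: "Q \<in> carrier_mat n n" "Q = transpose_mat B * Q * B + outer_prod w w"
    and p: "degree p = n"
  shows "transpose_mat (mat_poly (reflect_poly p) B) * Q * mat_poly (reflect_poly p) B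
      = transpose_mat (mat_poly p B) * Q * mat_poly p B
        + krylov (transpose_mat B) w * bezout_mat n (coeff p) * transpose_mat (krylov (transpose_mat B) w)"
    (is "?L = ?M + ?K * ?G * transpose_mat ?K")
proof (rule eq_matI)
  have T: "transpose_mat B \<in> carrier_mat n n" using B by simp
  have K: "?K \<in> carrier_mat n n" "transpose_mat ?K \<in> carrier_mat n n" using T by auto
  have M: "?M \<in> carrier_mat n n" using B Q(1) by (auto intro!: mult_carrier_mat[of _ n n _ n])
  fix i j assume "i < dim_row (?M + ?K * ?G * transpose_mat ?K)" "j < dim_col (?M + ?K * ?G * transpose_mat ?K)"
  then have ij: "i < n" "j < n" using K by auto
  define s where "s k l = (transpose_mat B ^\<^sub>m k * Q * B ^\<^sub>m l) $$ (i, j)" for k l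
  define x where "x k = (transpose_mat B ^\<^sub>m k *\<^sub>v w) $ i" for k
  define y where "y k = (transpose_mat B ^\<^sub>m k *\<^sub>v w) $ j" for k
  have step: "s k l = s (Suc k) (Suc l) + x k * y l" for k l
    unfolding s_def x_def y_def by (rule stein_pow_step[OF T B w w ij Q])
  have rp: "degree (reflect_poly p) \<le> n" using degree_reflect_poly_le[of p] p by simp
  have "?L $$ (i, j) = (\<Sum>k\<le>n. \<Sum>l\<le>n. coeff p (n - k) * coeff p (n - l) * s k l)"
    unfolding mat_poly_transpose_mult_mat_poly_index[OF B Q(1) rp ij] s_def
    by (intro sum.cong refl) (auto simp: coeff_reflect_poly p)
  also have "\<dots> = (\<Sum>k\<le>n. \<Sum>l\<le>n. coeff p k * coeff p l * s k l)
      + (\<Sum>k\<le>n. \<Sum>l\<le>n. bezout_num n (coeff p) k l * s k l)"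
    by (simp add: bezout_num_def left_diff_distrib sum_subtractf)
  also have "(\<Sum>k\<le>n. \<Sum>l\<le>n. coeff p k * coeff p l * s k l) = ?M $$ (i, j)"
    unfolding s_def by (rule mat_poly_transpose_mult_mat_poly_index[OF B Q(1) _ ij, symmetric]) (simp add: p)
  also have "(\<Sum>k\<le>n. \<Sum>l\<le>n. bezout_num n (coeff p) k l * s k l)
      = (\<Sum>m<n. \<Sum>l<n. x m * bezout_coeff n (coeff p) m l * y l)"
    by (rule bezout_displacement_sum[where s = s and x = x and y = y, OF step])
  also have "\<dots> = (\<Sum>l<n. (\<Sum>m<n. x m * bezout_coeff n (coeff p) m l) * y l)"
    by (subst sum.swap) (simp add: sum_distrib_right)
  also have "\<dots> = (?K * ?G * transpose_mat ?K) $$ (i, j)"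
    unfolding index_mult_mat_sum[OF mult_carrier_mat[OF K(1) bezout_mat_carrier] K(2) ij]
  proof (intro sum.cong refl arg_cong2[of _ _ _ _ "(*)"])
    fix l assume "l \<in> {..<n}"
    then have l: "l < n" by simp
    show "(\<Sum>m<n. x m * bezout_coeff n (coeff p) m l) = (?K * ?G) $$ (i, l)"
      unfolding index_mult_mat_sum[OF K(1) bezout_mat_carrier ij(1) l]
      using B ij l by (simp add: bezout_mat_def krylov_def x_def)
    show "y l = transpose_mat ?K $$ (l, j)"
      using B ij l by (simp add: krylov_def y_def)
  qed
  finally show "?L $$ (i, j) = (?M + ?K * ?G * transpose_mat ?K) $$ (i, j)"
    using ij K M by (simp del: index_mult_mat(1))
qed (use B Q(1) in \<open>auto simp: mat_poly_def krylov_def\<close>)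

section \<open>A Krylov solution of a modified Stein equation\<close>

text \<open>This is the source of existence: cancelling \<open>p^*(B)\<close> on the right turns
  \<open>S\<close> into a solution of the original equation.\<close>

lemma stein_krylov:
  fixes A :: "'a :: comm_ring_1 mat"
  assumes A: "A \<in> carrier_mat n n" and B: "B \<in> carrier_mat n n"
    and v: "v \<in> carrier_vec n" and w: "w \<in> carrier_vec n"
    and S: "S = char_krylov A v * exchange_mat n * transpose_mat (krylov (transpose_mat B) w)"
  shows "S = A * S * B + outer_prod v w * mat_poly (reflect_poly (char_poly A)) B"
    (is "_ = _ + ?vw * ?Psi")
proof (rule eq_matI)
  let ?N = "char_krylov A v" and ?O = "transpose_mat (krylov (transpose_mat B) w)"
  have vw: "?vw \<in> carrier_mat n n" using v w by simp
  have c: "?N \<in> carrier_mat n n" "?O \<in> carrier_mat n n" using A B by auto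
  have AN: "A * ?N \<in> carrier_mat n n" and OB: "?O * B \<in> carrier_mat n n"
    using A B c by (auto intro!: mult_carrier_mat[of _ n n _ n])
  fix i j assume "i < dim_row (A * S * B + ?vw * ?Psi)" "j < dim_col (A * S * B + ?vw * ?Psi)"
  then have ij: "i < n" "j < n" using v w B by (auto simp: outer_prod_def mat_poly_def)
  define x where "x t = (A ^\<^sub>m t *\<^sub>v v) $ i" for t
  define y where "y t = (transpose_mat B ^\<^sub>m t *\<^sub>v w) $ j" for t
  define a where "a = coeff (char_poly A)"
  have xS: "x (Suc t) = (\<Sum>r<n. A $$ (i, r) * (A ^\<^sub>m t *\<^sub>v v) $ r)" for t
  proof -
    have "A ^\<^sub>m Suc t *\<^sub>v v = A *\<^sub>v (A ^\<^sub>m t *\<^sub>v v)"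
      unfolding pow_mat_Suc_left[OF A] using A v by (intro assoc_mult_mat_vec) auto
    then show ?thesis using A v ij by (auto simp: x_def scalar_prod_def atLeast0LessThan simp del: pow_mat.simps)
  qed
  have yS: "y (Suc t) = (\<Sum>r<n. B $$ (r, j) * (transpose_mat B ^\<^sub>m t *\<^sub>v w) $ r)" for t
  proof -
    have "transpose_mat B ^\<^sub>m Suc t *\<^sub>v w = transpose_mat B *\<^sub>v (transpose_mat B ^\<^sub>m t *\<^sub>v w)"
      unfolding pow_mat_Suc_left[OF transpose_carrier_mat[THEN iffD2, OF B]]
      using B w by (intro assoc_mult_mat_vec) auto
    then show ?thesis using B w ij by (auto simp: y_def scalar_prod_def atLeast0LessThan simp del: pow_mat.simps)
  qed
  have ANi: "(A * ?N) $$ (i, m) = (\<Sum>k\<in>{m<..n}. a k * x (Suc (k - 1 - m)))" if "m < n" for m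
    unfolding index_mult_mat_sum[OF A c(1) ij(1) that] xS sum_distrib_left
    by (subst sum.swap) (use A that in \<open>auto simp: char_krylov_def a_def sum_distrib_left ac_simps intro!: sum.cong\<close>)
  have OBi: "(?O * B) $$ (m, j) = y (Suc m)" if "m < n" for m
    unfolding index_mult_mat_sum[OF c(2) B that ij(2)] yS
    using B that by (intro sum.cong) (auto simp: krylov_def mult.commute)
  have S1: "S $$ (i, j) = (\<Sum>k\<le>n. a k * (\<Sum>l<k. x l * y (n - k + l)))"
  proof -
    have "S $$ (i, j) = (\<Sum>m<n. ?N $$ (i, m) * y (n - 1 - m))"
      unfolding S mult_exchange_mult_index[OF c ij] using B ij by (simp add: krylov_def y_def)
    also have "\<dots> = (\<Sum>k\<le>n. \<Sum>l<k. a k * x l * y (n - 1 - (k - 1 - l)))"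
      unfolding a_def x_def by (rule krylov_char_sum[OF A ij(1)])
    finally show ?thesis
      by (auto simp: sum_distrib_left ac_simps intro!: sum.cong arg_cong[of _ _ y])
  qed
  have S2: "(A * S * B) $$ (i, j) = (\<Sum>k\<le>n. a k * (\<Sum>l<k. x (Suc l) * y (Suc (n - k + l))))"
  proof -
    have "A * S * B = (A * ?N) * exchange_mat n * (?O * B)"
      unfolding S using A B c by (simp add: assoc_mult_mat[of _ n n _ n _ n] mult_carrier_mat[of _ n n _ n])
    then have "(A * S * B) $$ (i, j) = (\<Sum>m<n. (A * ?N) $$ (i, m) * (?O * B) $$ (n - 1 - m, j))"
      using mult_exchange_mult_index[OF AN OB ij] by simp
    also have "\<dots> = (\<Sum>m<n. \<Sum>k\<in>{m<..n}. a k * x (Suc (k - 1 - m)) * y (Suc (n - 1 - m)))"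
      by (intro sum.cong refl) (simp add: ANi OBi sum_distrib_right del: index_mult_mat(1))
    also have "\<dots> = (\<Sum>k\<le>n. \<Sum>l<k. a k * x (Suc l) * y (Suc (n - 1 - (k - 1 - l))))"
      unfolding sum_triangle_reindex by (intro sum.cong refl) auto
    finally show ?thesis
      by (auto simp: sum_distrib_left ac_simps intro!: sum.cong arg_cong[of _ _ y])
  qed
  have xy: "(A ^\<^sub>m t * (?vw * B ^\<^sub>m l)) $$ (i, j) = x t * y l" for t l
    using pow_outer_prod_pow_index[OF A B v w ij, of t l] A B vw
    by (simp add: x_def y_def assoc_mult_mat[of _ n n _ n _ n] del: index_mult_mat(1))
  have S3: "(?vw * ?Psi) $$ (i, j) = (\<Sum>k\<le>n. a k * (x 0 * y (n - k)))"
    unfolding mult_reflect_char_poly_index[OF A B vw ij] a_def xy[symmetric]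
    using A B vw by (simp add: left_mult_one_mat[of _ n n] mult_carrier_mat[of _ n n _ n] del: index_mult_mat(1))
  \<comment> \<open>Adding this vanishing sum supplies the end term that closes the telescope
    below.\<close>
  have zero: "(\<Sum>k\<le>n. a k * (x k * y n)) = 0"
    using char_poly_pow_sum[OF A _ ij, of "?vw * B ^\<^sub>m n"] vw B
    unfolding xy[symmetric] a_def by (simp add: mult_carrier_mat[of _ n n _ n] del: index_mult_mat(1))
  have tel: "(\<Sum>l<k. x l * y (m + l)) + x k * y (m + k) = (\<Sum>l<k. x (Suc l) * y (Suc (m + l))) + x 0 * y m" for k m
    by (induction k) (auto simp: ac_simps)
  have "S $$ (i, j) = (\<Sum>k\<le>n. a k * ((\<Sum>l<k. x l * y (n - k + l)) + x k * y n))"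
    unfolding S1 distrib_left sum.distrib zero by simp
  also have "\<dots> = (\<Sum>k\<le>n. a k * ((\<Sum>l<k. x (Suc l) * y (Suc (n - k + l))) + x 0 * y (n - k)))"
  proof (intro sum.cong refl arg_cong2[of _ _ _ _ "(*)"])
    fix k assume "k \<in> {..n}"
    then show "(\<Sum>l<k. x l * y (n - k + l)) + x k * y n = (\<Sum>l<k. x (Suc l) * y (Suc (n - k + l))) + x 0 * y (n - k)"
      using tel[where k = k and m = "n - k"] by simp
  qed
  also have "\<dots> = (A * S * B) $$ (i, j) + (?vw * ?Psi) $$ (i, j)"
    unfolding S2 S3 by (simp add: distrib_left sum.distrib)
  finally show "S $$ (i, j) = (A * S * B + ?vw * ?Psi) $$ (i, j)"
    using ij vw B carrier_matD[OF mat_poly_carrier[OF B, of "reflect_poly (char_poly A)"]] by (simp del: index_mult_mat(1))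
qed (use A B v w S in \<open>auto simp: mat_poly_def krylov_def char_krylov_def outer_prod_def\<close>)

section \<open>The determinant identity\<close>

lemma det_nonzero_inverse:
  fixes A :: "'a :: field mat"
  assumes A: "A \<in> carrier_mat n n" and d: "det A \<noteq> 0"
  obtains X where "X \<in> carrier_mat n n" "A * X = 1\<^sub>m n" "X * A = 1\<^sub>m n"
  using det_non_zero_imp_unit[OF A d, where b = "()"] by (auto simp: Units_def ring_mat_def)

text \<open>Every solution satisfies \<open>R p^*(B) = S\<close> with the same \<open>S\<close>,
  which forces uniqueness; conversely \<open>S\<close> times the inverse of \<open>p^*(B)\<close> is
  a solution.\<close>

lemma stein_solution_ex1:
  fixes A :: "real mat"
  assumes A: "A \<in> carrier_mat n n" and B: "B \<in> carrier_mat n n"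
    and v: "v \<in> carrier_vec n" and w: "w \<in> carrier_vec n"
    and d: "det (mat_poly (reflect_poly (char_poly A)) B) \<noteq> 0"
  shows "\<exists>!R. stein_solution n A B (outer_prod v w) R"
proof -
  let ?Psi = "mat_poly (reflect_poly (char_poly A)) B"
  define S where "S = char_krylov A v * exchange_mat n * transpose_mat (krylov (transpose_mat B) w)"
  note [intro] = mult_carrier_mat[of _ n n _ n]
  have S: "S \<in> carrier_mat n n" using A B by (simp add: S_def mult_carrier_mat[of _ n n _ n])
  have Psi: "?Psi \<in> carrier_mat n n" using B by simp
  have vw: "outer_prod v w \<in> carrier_mat n n" using v w by simp
  obtain X where X: "X \<in> carrier_mat n n" "?Psi * X = 1\<^sub>m n" "X * ?Psi = 1\<^sub>m n"
    using det_nonzero_inverse[OF Psi d] .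
  \<comment> \<open>\<open>X\<close> inherits this from \<open>p^*(B)\<close>; it lets
    \<open>X\<close> move past \<open>B\<close> inside \<open>A S B X\<close>.\<close>
  have comm: "X * B = B * X"
  proof -
    have "X * B = X * (B * (?Psi * X))"
      using B X by (simp add: right_mult_one_mat[of _ n n])
    also have "\<dots> = X * ((B * ?Psi) * X)"
      using B X Psi by (simp add: assoc_mult_mat[of _ n n _ n _ n])
    also have "\<dots> = (X * ?Psi) * (B * X)"
      unfolding mat_poly_commute[OF B] using B X(1) Psi by (simp add: assoc_mult_mat[of _ n n _ n _ n] mult_carrier_mat[of _ n n _ n])
    also have "\<dots> = B * X"
      unfolding X(3) using B X(1) by (intro left_mult_one_mat[of _ n n]) auto
    finally show ?thesis .
  qed
  show ?thesis
  proof (rule ex1I[of _ "S * X"])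
    have "S * X = (A * S * B + outer_prod v w * ?Psi) * X"
      using stein_krylov[OF A B v w S_def] by simp
    also have "\<dots> = A * S * (B * X) + outer_prod v w * (?Psi * X)"
      using A B S X(1) Psi vw by (simp add: add_mult_distrib_mat[of _ n n _ _ n]
          assoc_mult_mat[of _ n n _ n _ n] mult_carrier_mat[of _ n n _ n])
    also have "\<dots> = A * (S * X) * B + outer_prod v w"
      unfolding comm[symmetric] X(2) using A B S X(1) vw
      by (simp add: assoc_mult_mat[of _ n n _ n _ n] mult_carrier_mat[of _ n n _ n] right_mult_one_mat[of _ n n])
    finally show "stein_solution n A B (outer_prod v w) (S * X)"
      using S X(1) by (auto simp: stein_solution_def)
  next
    fix R assume "stein_solution n A B (outer_prod v w) R"
    then have R: "R \<in> carrier_mat n n" "R = A * R * B + outer_prod v w"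
      by (auto simp: stein_solution_def)
    have "R * ?Psi = S"
      unfolding S_def by (rule stein_mult_reflect_char_poly[OF A B v w R])
    then have "S * X = R * (?Psi * X)"
      using R(1) Psi X(1) by (auto simp: assoc_mult_mat[of _ n n _ n _ n])
    then show "R = S * X" using R(1) X(2) by (simp add: right_mult_one_mat[of _ n n])
  qed
qed

text \<open>At \<open>transpose_mat A\<close> the term with \<open>p\<close> vanishes from the
  Bezoutian identity. What remains is rewritten by \<open>P p^*(A^T) = N J K^T\<close>, and
  \<open>K\<close> and \<open>J\<close> are cancelled.\<close>

lemma stein_inverse_gram:
  fixes A P X :: "'a :: field mat"
  assumes A: "A \<in> carrier_mat n n" and v: "v \<in> carrier_vec n"
    and P: "P \<in> carrier_mat n n" "P = A * P * transpose_mat A + outer_prod v v"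
    and d: "det (mat_poly (reflect_poly (char_poly A)) (transpose_mat A)) \<noteq> 0"
    and X: "X \<in> carrier_mat n n" "P * X = 1\<^sub>m n" "X * P = 1\<^sub>m n"
  shows "transpose_mat (char_krylov A v) * X * char_krylov A v = bezout_mat n (coeff (char_poly A))"
proof -
  let ?p = "char_poly A" and ?N = "char_krylov A v" and ?J = "exchange_mat n :: 'a mat"
  let ?K = "krylov A v" and ?Psi = "mat_poly (reflect_poly (char_poly A)) (transpose_mat A)"
  let ?G = "bezout_mat n (coeff ?p)"
  note [simp] = assoc_mult_mat[of _ n n _ n _ n] mult_carrier_mat[of _ n n _ n]
    left_mult_one_mat[of _ n n] right_mult_one_mat[of _ n n]
  have T: "transpose_mat A \<in> carrier_mat n n" using A by simp
  have K: "?K \<in> carrier_mat n n" and N: "?N \<in> carrier_mat n n"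
    and KT: "transpose_mat ?K \<in> carrier_mat n n" and NT: "transpose_mat ?N \<in> carrier_mat n n"
    using A by auto
  have J: "?J \<in> carrier_mat n n" and G: "?G \<in> carrier_mat n n" by auto
  have Psi: "?Psi \<in> carrier_mat n n" using T by simp
  have PPsi: "P * ?Psi = ?N * ?J * transpose_mat ?K"
    using stein_mult_reflect_char_poly[OF A T v v P] by simp
  have "det P \<noteq> 0" using det_mult[OF P(1) X(1)] X(2) by auto
  moreover have "det P * det ?Psi = det ?N * (det ?J * det ?K)"
    using arg_cong[OF PPsi, of det] P(1) Psi N J K KT
    by (simp add: det_mult[of _ n] det_transpose[OF K])
  \<comment> \<open>\<open>P\<close> and \<open>p^*(A^T)\<close> are invertible, hence so is each
    factor of their product, in particular \<open>K\<close>.\<close>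
  ultimately have dK: "det ?K \<noteq> 0"
    using d by (metis mult_eq_0_iff)
  \<comment> \<open>The transpose solves the same equation, so both have the same product with the
    invertible \<open>p^*(A^T)\<close>.\<close>
  have PT: "transpose_mat P = P"
  proof -
    have PP: "transpose_mat P \<in> carrier_mat n n" using P(1) by simp
    have "transpose_mat P = transpose_mat (A * P * transpose_mat A + outer_prod v v)" using P(2) by simp
    also have "\<dots> = A * transpose_mat P * transpose_mat A + outer_prod v v"
      using A P(1) v PP T
      by (simp add: transpose_add[of _ n n] transpose_mult[of _ n n _ n] transpose_outer_prod)
    finally have "transpose_mat P * ?Psi = ?N * ?J * transpose_mat ?K"
      using stein_mult_reflect_char_poly[OF A T v v PP] by simp
    then have eq: "transpose_mat P * ?Psi = P * ?Psi" using PPsi by simp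
    obtain Y where Y: "Y \<in> carrier_mat n n" "?Psi * Y = 1\<^sub>m n"
      using det_nonzero_inverse[OF Psi d] by metis
    have "transpose_mat P = (transpose_mat P * ?Psi) * Y" using PP Psi Y by simp
    also have "\<dots> = P" unfolding eq using P(1) Psi Y by simp
    finally show ?thesis .
  qed
  have "mat_poly ?p (transpose_mat A) = 0\<^sub>m n n"
    using cayley_hamilton[OF T] char_poly_transpose_mat[OF A] by simp
  then have "transpose_mat ?Psi * P * ?Psi = ?K * ?G * transpose_mat ?K"
    using stein_bezout[OF T v P(1) _ conjunct1[OF degree_monic_char_poly[OF A]]] P K KT G
    by (simp add: right_mult_zero_mat[of _ n n])
  moreover have "transpose_mat ?Psi * P * ?Psi = ?K * (?J * (transpose_mat ?N * X * ?N) * ?J) * transpose_mat ?K"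
  proof -
    have "transpose_mat ?Psi * P = transpose_mat (P * ?Psi)"
      using Psi P(1) PT by (simp add: transpose_mult[of _ n n _ n])
    also have "\<dots> = ?K * (?J * transpose_mat ?N)"
      unfolding PPsi using N J K KT by (simp add: transpose_mult[of _ n n _ n] transpose_exchange_mat)
    finally have 1: "transpose_mat ?Psi * P = ?K * (?J * transpose_mat ?N)" .
    \<comment> \<open>Inserting \<open>X P = I\<close> exposes \<open>P p^*(A^T)\<close> on the
      right as well as its transpose on the left.\<close>
    have "transpose_mat ?Psi * P * ?Psi = (transpose_mat ?Psi * P) * (X * (P * ?Psi))"
    proof -
      have "X * (P * ?Psi) = (X * P) * ?Psi" using X(1) P(1) Psi by simp
      then show ?thesis using X(3) Psi by simp
    qed
    also have "\<dots> = ?K * (?J * transpose_mat ?N) * (X * (?N * ?J * transpose_mat ?K))"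
      unfolding 1 PPsi ..
    also have "\<dots> = ?K * (?J * (transpose_mat ?N * X * ?N) * ?J) * transpose_mat ?K"
      using N NT J K KT X(1) by simp
    finally show ?thesis .
  qed
  ultimately have eq: "?K * (?J * (transpose_mat ?N * X * ?N) * ?J) * transpose_mat ?K = ?K * ?G * transpose_mat ?K"
    by simp
  obtain L where L: "L \<in> carrier_mat n n" "L * ?K = 1\<^sub>m n"
    using det_nonzero_inverse[OF K dK] by metis
  have LT: "transpose_mat L \<in> carrier_mat n n" "transpose_mat ?K * transpose_mat L = 1\<^sub>m n"
    using L K by (auto simp: transpose_mult[of _ n n _ n, symmetric])
  have cancel: "L * (?K * M * transpose_mat ?K) * transpose_mat L = M" if M: "M \<in> carrier_mat n n" for M
  proof -
    have "L * (?K * M * transpose_mat ?K) * transpose_mat L = (L * ?K) * M * (transpose_mat ?K * transpose_mat L)"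
      using L(1) LT(1) K KT M by simp
    then show ?thesis using L(2) LT(2) M by simp
  qed
  have "?J * (transpose_mat ?N * X * ?N) * ?J = ?G"
  proof -
    have M: "?J * (transpose_mat ?N * X * ?N) * ?J \<in> carrier_mat n n"
      using N NT J X(1) by simp
    show ?thesis
      using cancel[OF M] cancel[OF G] unfolding eq by (rule trans[OF sym])
  qed
  then have "?J * (?J * (transpose_mat ?N * X * ?N) * ?J) * ?J = ?G"
    using exchange_bezout_exchange[of n "coeff ?p"] by (rule ssubst)
  moreover have "?J * (?J * (transpose_mat ?N * X * ?N) * ?J) * ?J
      = (?J * ?J) * (transpose_mat ?N * X * ?N) * (?J * ?J)"
    using N NT J X(1) by simp
  ultimately show "transpose_mat ?N * X * ?N = ?G"
    using N NT X(1) by (simp add: exchange_mat_square)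
qed

text \<open>The spectral hypothesis enters only through \<open>dP\<close> and \<open>dR\<close>,
  which makes the identity algebraic and valid over any field.\<close>

lemma det_stein_identity:
  fixes A :: "'a :: field mat"
  assumes A: "A \<in> carrier_mat n n" and v: "v \<in> carrier_vec n" and w: "w \<in> carrier_vec n"
    and B: "B = A + outer_prod v w"
    and dP: "det (mat_poly (reflect_poly (char_poly A)) (transpose_mat A)) \<noteq> 0"
    and dR: "det (mat_poly (reflect_poly (char_poly A)) B) \<noteq> 0"
    and P: "P \<in> carrier_mat n n" "P = A * P * transpose_mat A + outer_prod v v"
    and Q: "Q \<in> carrier_mat n n" "Q = transpose_mat B * Q * B + outer_prod w w"
    and R: "R \<in> carrier_mat n n" "R = A * R * B + outer_prod v w"
  shows "(det R)\<^sup>2 * det (1\<^sub>m n + P * Q) = det P * det Q"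
proof -
  let ?p = "char_poly A" and ?N = "char_krylov A v" and ?J = "exchange_mat n :: 'a mat"
  let ?K = "krylov A v" and ?Psi = "mat_poly (reflect_poly (char_poly A)) B"
  let ?Phi = "mat_poly (char_poly A) B" and ?O = "transpose_mat (krylov (transpose_mat B) w)"
  let ?G = "bezout_mat n (coeff ?p)"
  note [simp] = assoc_mult_mat[of _ n n _ n _ n] mult_carrier_mat[of _ n n _ n]
    left_mult_one_mat[of _ n n] right_mult_one_mat[of _ n n]
  have Bc: "B \<in> carrier_mat n n" using A v w B by simp
  have T: "transpose_mat A \<in> carrier_mat n n" using A by simp
  have N: "?N \<in> carrier_mat n n" and K: "?K \<in> carrier_mat n n" and KT: "transpose_mat ?K \<in> carrier_mat n n"
    and NT: "transpose_mat ?N \<in> carrier_mat n n" using A by auto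
  have Oc: "krylov (transpose_mat B) w \<in> carrier_mat n n" using Bc by simp
  have O: "?O \<in> carrier_mat n n" using Oc by simp
  have J: "?J \<in> carrier_mat n n" and G: "?G \<in> carrier_mat n n" by auto
  have Psi: "?Psi \<in> carrier_mat n n" and Phi: "?Phi \<in> carrier_mat n n" using Bc by auto
  \<comment> \<open>Only squares of determinants matter later, so the sign of \<open>det J\<close>
    need not be computed.\<close>
  have detJ: "(det ?J)\<^sup>2 = 1"
    using det_mult[OF J J] by (simp add: exchange_mat_square power2_eq_square)
  have RPsi: "R * ?Psi = ?N * ?J * ?O"
    by (rule stein_mult_reflect_char_poly[OF A Bc v w R])
  have detR: "det R * det ?Psi = det ?N * det ?J * det ?O"
    using arg_cong[OF RPsi, of det] R(1) Psi N J O by (simp add: det_mult[of _ n])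
  have detP: "det P * det (mat_poly (reflect_poly ?p) (transpose_mat A)) = det ?N * det ?J * det ?K"
  proof -
    have "P * mat_poly (reflect_poly ?p) (transpose_mat A) = ?N * ?J * transpose_mat ?K"
      using stein_mult_reflect_char_poly[OF A T v v P] by simp
    from arg_cong[OF this, of det] show ?thesis
      using P(1) T N J K KT by (simp add: det_mult[of _ n] det_transpose[OF K])
  qed
  show ?thesis
  proof (cases "det P = 0")
    case True
    \<comment> \<open>By \<open>detP\<close> either \<open>N\<close> or \<open>K\<close> is
      singular, and a singular \<open>K\<close> makes its multiple \<open>N\<close> singular. Then
      \<open>detR\<close> forces \<open>det R = 0\<close>.\<close>
    have "det ?N = 0"
    proof (rule ccontr)
      assume "det ?N \<noteq> 0"
      then have "det ?K = 0" using detP detJ True by (auto simp: power2_eq_square)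
      then have "det ?N = 0"
        unfolding char_krylov_eq_krylov_mult[OF A] by (subst det_mult[OF K]) auto
      then show False using \<open>det ?N \<noteq> 0\<close> by simp
    qed
    then show ?thesis using detR dR True by simp
  next
    case False
    obtain X where X: "X \<in> carrier_mat n n" "P * X = 1\<^sub>m n" "X * P = 1\<^sub>m n"
      using det_nonzero_inverse[OF P(1) False] .
    have PhiNO: "?Phi = ?N * ?O" by (rule char_poly_rank_one_update[OF A v w B])
    have gram: "transpose_mat ?N * X * ?N = ?G"
      by (rule stein_inverse_gram[OF A v P dP X])
    have "transpose_mat ?Psi * Q * ?Psi = transpose_mat ?Phi * Q * ?Phi + transpose_mat ?O * ?G * ?O"
      using stein_bezout[OF Bc w Q conjunct1[OF degree_monic_char_poly[OF A]]] by simp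
    \<comment> \<open>Replacing \<open>G\<close> by \<open>N^T X N\<close> assembles
      \<open>N O\<close>, which is \<open>p(B)\<close>, on both sides of \<open>X\<close>.\<close>
    also have "transpose_mat ?O * ?G * ?O = transpose_mat ?Phi * X * ?Phi"
      unfolding gram[symmetric] PhiNO
      using N NT O Oc X(1) by (simp add: transpose_mult[of _ n n _ n])
    also have "transpose_mat ?Phi * Q * ?Phi + transpose_mat ?Phi * X * ?Phi = transpose_mat ?Phi * (X + Q) * ?Phi"
      using Phi X(1) Q(1)
      by (simp add: add_mult_distrib_mat[of _ n n _ _ n] mult_add_distrib_mat[of _ n n _ n] comm_add_mat[of _ n n])
    finally have key: "transpose_mat ?Psi * Q * ?Psi = transpose_mat ?Phi * (X + Q) * ?Phi" .
    have "P * (X + Q) = 1\<^sub>m n + P * Q"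
      using P(1) X Q(1) by (simp add: mult_add_distrib_mat[of _ n n _ n])
    then have dI: "det (1\<^sub>m n + P * Q) = det P * det (X + Q)"
      using P(1) X(1) Q(1) by (metis add_carrier_mat det_mult)
    have "(det ?Psi)\<^sup>2 * det Q = (det ?Phi)\<^sup>2 * det (X + Q)"
      using arg_cong[OF key, of det] Psi Phi Q(1) X(1)
      by (simp add: det_mult[of _ n] det_transpose[of _ n] power2_eq_square ac_simps)
    moreover have "(det ?Phi)\<^sup>2 = (det R)\<^sup>2 * (det ?Psi)\<^sup>2"
      unfolding power_mult_distrib[symmetric] detR PhiNO det_mult[OF N O]
      using detJ by (simp add: power_mult_distrib)
    ultimately have "(det ?Psi)\<^sup>2 * det Q = (det ?Psi)\<^sup>2 * ((det R)\<^sup>2 * det (X + Q))"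
      by (simp add: ac_simps)
    then have "det Q = (det R)\<^sup>2 * det (X + Q)" using dR by simp
    then show ?thesis unfolding dI by (simp add: ac_simps)
  qed
qed

lemma complex_spectrum_transpose:
  assumes "A \<in> carrier_mat n n"
  shows "complex_spectrum (transpose_mat A) = complex_spectrum A"
proof -
  let ?C = "map_mat complex_of_real A"
  have C: "?C \<in> carrier_mat n n" "transpose_mat ?C \<in> carrier_mat n n" using assms by auto
  have *: "map_mat complex_of_real (transpose_mat A) = transpose_mat ?C" by auto
  show ?thesis
    unfolding * spectrum_def eigenvalue_root_char_poly[OF C(1)] eigenvalue_root_char_poly[OF C(2)]
      char_poly_transpose_mat[OF C(1)] ..
qed

theorem corollary11:
  fixes n :: nat and A A2 :: "real mat" and v w :: "real vec"
  assumes "n \<ge> 1"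
    and "A \<in> carrier_mat n n"
    and "v \<in> carrier_vec n"
    and "w \<in> carrier_vec n"
    and "A2 = A + outer_prod v w"
    and "\<forall>\<alpha> \<in> complex_spectrum A \<union> complex_spectrum A2.
         \<forall>\<beta> \<in> complex_spectrum A \<union> complex_spectrum A2. \<alpha> * \<beta> \<noteq> 1"
  shows "(\<exists>!P. stein_solution n A (transpose_mat A) (outer_prod v v) P) \<and>
    (\<exists>!Q. stein_solution n (transpose_mat A2) A2 (outer_prod w w) Q) \<and>
    (\<exists>!R. stein_solution n A A2 (outer_prod v w) R) \<and>
    (\<forall>P Q R. stein_solution n A (transpose_mat A) (outer_prod v v) P \<longrightarrow>
      stein_solution n (transpose_mat A2) A2 (outer_prod w w) Q \<longrightarrow>
      stein_solution n A A2 (outer_prod v w) R \<longrightarrow>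
      (det R)\<^sup>2 * det (1\<^sub>m n + P * Q) = det P * det Q)"
proof -
  note A = assms(2) and v = assms(3) and w = assms(4)
  have A2: "A2 \<in> carrier_mat n n" using A v w assms(5) by simp
  have AT: "transpose_mat A \<in> carrier_mat n n" and A2T: "transpose_mat A2 \<in> carrier_mat n n"
    using A A2 by auto
  \<comment> \<open>The three equations consume the three kinds of eigenvalue products: within
    \<open>A\<close>, within \<open>A2\<close>, and across; transposition leaves spectra
    unchanged.\<close>
  have dP: "det (mat_poly (reflect_poly (char_poly A)) (transpose_mat A)) \<noteq> 0"
    using assms(6) complex_spectrum_transpose[OF A] by (intro det_mat_poly_reflect_char_poly[OF A AT]) auto
  have dQ: "det (mat_poly (reflect_poly (char_poly (transpose_mat A2))) A2) \<noteq> 0"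
    using assms(6) complex_spectrum_transpose[OF A2] by (intro det_mat_poly_reflect_char_poly[OF A2T A2]) auto
  have dR: "det (mat_poly (reflect_poly (char_poly A)) A2) \<noteq> 0"
    using assms(6) by (intro det_mat_poly_reflect_char_poly[OF A A2]) auto
  show ?thesis
  proof (intro conjI allI impI)
    fix P Q R
    assume "stein_solution n A (transpose_mat A) (outer_prod v v) P"
      "stein_solution n (transpose_mat A2) A2 (outer_prod w w) Q"
      "stein_solution n A A2 (outer_prod v w) R"
    then show "(det R)\<^sup>2 * det (1\<^sub>m n + P * Q) = det P * det Q"
      unfolding stein_solution_def
      by (elim conjE) (rule det_stein_identity[OF A v w assms(5) dP dR])
  qed (rule stein_solution_ex1[OF A AT v v dP] stein_solution_ex1[OF A2T A2 w w dQ]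
      stein_solution_ex1[OF A A2 v w dR])+
qed

end
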